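(* Let $\mathbf{R}(\mathbf{u})=\mathbf{A}\mathbf{u}$ with $\mathbf{A}\in\mathbb{R}^{N\times N}$ a constant matrix (a linear time-invariant operator). Let $\mathbf{u}_F,\tilde{\mathbf{u}}_G,\tilde{\mathbf{u}}_A:[0,T]\to\mathbb{R}^N$ solve $$\frac{d\mathbf{u}_F}{dt}=\mathbf{A}\mathbf{u}_F,\qquad \frac{d\tilde{\mathbf{u}}_G}{dt}=\mathbb{P}_G\mathbf{A}\tilde{\mathbf{u}}_G,\qquad \frac{d\tilde{\mathbf{u}}_A}{dt}=\mathbb{P}_A\mathbf{A}\tilde{\mathbf{u}}_A,\qquad \mathbf{u}_F(0)=\tilde{\mathbf{u}}_G(0)=\tilde{\mathbf{u}}_A(0)=\mathbf{u}_0,$$ where $\mathbb{P}_G=\tilde{\Pi}$ and $\mathbb{P}_A=\tilde{\Pi}[\mathbf{I}+\tau\mathbf{A}\Pi']$. Define the coarse-scale errors $\tilde{\mathbf{e}}_G=\tilde{\Pi}\mathbf{u}_F-\tilde{\mathbf{u}}_G$ and $\tilde{\mathbf{e}}_A=\tilde{\Pi}\mathbf{u}_F-\tilde{\mathbf{u}}_A$. Suppose $\tilde{\mathbf{V}}^T\mathbb{P}_G\mathbf{A}\tilde{\mathbf{V}}=\mathbf{S}_G\Lambda_G\mathbf{S}_G^{-1}$ and $\tilde{\mathbf{V}}^T\mathbb{P}_A\mathbf{A}\tilde{\mathbf{V}}=\mathbf{S}_A\Lambda_A\mathbf{S}_A^{-1}$ are eigendecompositions, with $\Lambda_G,\Lambda_A$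 diagonal matrices of eigenvalues and $\mathbf{S}_G,\mathbf{S}_A$ invertible matrices of eigenvectors. Then for all $t\in[0,T]$, $$\|\tilde{\mathbf{e}}_G(t)\|_2\le\|\mathbf{S}_G\|_2\|\mathbf{S}_G^{-1}\|_2\int_0^t\|e^{\Lambda_G(t-s)}\|_2\,\|\tilde{\mathbf{V}}^T\mathbb{P}_G\mathbf{r}_F(\tilde{\mathbf{u}}_F(s))\|_2\,ds,$$ $$\|\tilde{\mathbf{e}}_A(t)\|_2\le\|\mathbf{S}_A\|_2\|\mathbf{S}_A^{-1}\|_2\int_0^t\|e^{\Lambda_A(t-s)}\|_2\,\|\tilde{\mathbf{V}}^T\mathbb{P}_A\mathbf{r}_F(\tilde{\mathbf{u}}_F(s))\|_2\,ds.$$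
   Context: $N,K$ are positive integers with $K\le N$, and $T>0$. $\tilde{\mathbf{V}}\in\mathbb{R}^{N\times K}$ is a matrix with orthonormal columns (the coarse-scale trial basis). $\tilde{\Pi}=\tilde{\mathbf{V}}\tilde{\mathbf{V}}^T$ and $\Pi'=\mathbf{I}-\tilde{\mathbf{V}}\tilde{\mathbf{V}}^T$. $\tau\ge0$ is a fixed real constant. The initial condition satisfies $\mathbf{u}_0\in\mathrm{Range}(\tilde{\mathbf{V}})$. $\tilde{\mathbf{u}}_F=\tilde{\Pi}\mathbf{u}_F$ is the coarse-scale part of the full-order solution. The residual of the full-order model is $\mathbf{r}_F(\mathbf{u})=\frac{d\mathbf{u}}{dt}-\mathbf{A}\mathbf{u}$ for a differentiable trajectory $\mathbf{u}$, so $\mathbf{r}_F(\tilde{\mathbf{u}}_F(s))=\frac{d\tilde{\mathbf{u}}_F}{dt}(s)-\mathbf{A}\tilde{\mathbf{u}}_F(s)$. $\|\cdot\|_2$ is the Euclidean norm for (real or complex) vectors and the induced operator norm for matrices; eigenvalues and eigenvectors may be complex. *)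

theory Defs
  imports "HOL-Analysis.Analysis"
begin

definition orthonormal_columns :: "real^'k^'n \<Rightarrow> bool" where
  "orthonormal_columns V \<longleftrightarrow>
     (\<forall>i j. column i V \<bullet> column j V = (if i = j then 1 else 0))"

definition coarse_proj :: "real^'k^'n \<Rightarrow> real^'n^'n" where
  "coarse_proj V = V ** transpose V"

definition fine_proj :: "real^'k^'n \<Rightarrow> real^'n^'n" where
  "fine_proj V = mat 1 - V ** transpose V"

definition proj_G :: "real^'k^'n \<Rightarrow> real^'n^'n" where
  "proj_G V = coarse_proj V"

definition proj_A :: "real \<Rightarrow> real^'n^'n \<Rightarrow> real^'k^'n \<Rightarrow> real^'n^'n" where
  "proj_A \<tau> A V = coarse_proj V ** (mat 1 + \<tau> *\<^sub>R (A ** fine_proj V))"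

text \<open>Residual of the full-order model along a trajectory on \<open>[0, T]\<close>. The time
  derivative is relative to \<open>{0..T}\<close>, so it is one-sided at the endpoints; it is
  meaningful for \<open>T > 0\<close> and a trajectory that is differentiable on \<open>{0..T}\<close>.\<close>

definition residual_F :: "real^'n^'n \<Rightarrow> real \<Rightarrow> (real \<Rightarrow> real^'n) \<Rightarrow> real \<Rightarrow> real^'n" where
  "residual_F A T u s = vector_derivative u (at s within {0..T}) - A *v u s"

text \<open>The type \<open>complex^'k^'k\<close> carries no Banach algebra structure for matrix
  multiplication, so \<open>exp\<close> is not available; the exponential is given by its power
  series, with the limit taken entrywise.\<close>

definition matrix_exp :: "complex^'k^'k \<Rightarrow> complex^'k^'k" where
  "matrix_exp M = (\<Sum>p. (1 / fact p) *\<^sub>R (((**) M ^^ p) (mat 1)))"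

text \<open>The norm of the vector type \<open>complex^'k\<close> is the Euclidean one, whereas the
  norm inherited by \<open>complex^'k^'k\<close> is the Frobenius norm and not the induced one.\<close>

definition matrix_norm2 :: "complex^'k^'m \<Rightarrow> real" where
  "matrix_norm2 M = onorm ((*v) M)"

text \<open>Eigenvalues and eigenvectors of a real matrix may be complex, so \<open>M\<close> is read as a
  complex matrix. With \<open>S\<close> invertible and \<open>L\<close> diagonal, the equation says that the
  columns of \<open>S\<close> are eigenvectors of \<open>M\<close> for the diagonal entries of \<open>L\<close>.\<close>

definition eigendecomposition ::
    "real^'k^'k \<Rightarrow> complex^'k^'k \<Rightarrow> complex^'k^'k \<Rightarrow> bool" where
  "eigendecomposition M S L \<longleftrightarrow>
     invertible S \<and>
     (\<forall>i j. i \<noteq> j \<longrightarrow> L $ i $ j = 0) \<and>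
     map_matrix complex_of_real M = S ** L ** matrix_inv S"

end

theory Submission
  imports Defs
begin

text \<open>
  Both reduced models are instances of one: a trajectory driven by \<open>P ** A\<close> for a matrix
  \<open>P\<close> that maps into the coarse space and fixes it pointwise. The adjoint Petrov-Galerkin
  projector has these properties because its correction term annihilates the coarse space
  and is followed by the coarse projection.

  The coarse part \<open>w\<close> of the full-order solution has its time derivative in the coarse space,
  so \<open>P\<close> fixes that derivative, and hence \<open>w' = P A w + P r\<close> with \<open>r\<close> the residual of \<open>w\<close>.
  The error \<open>e\<close> therefore solves \<open>e' = P A e + P r\<close> with \<open>e(0) = 0\<close>. It stays in the
  coarse space, because the reduced trajectory does: its fine part has zero derivative and
  starts at zero. In the coordinates \<open>a = V\<^sup>T e\<close>, which preserve the Euclidean norm on the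
  coarse space, the equation reads \<open>a' = (V\<^sup>T P A V) a + V\<^sup>T P r\<close>.

  An eigendecomposition \<open>S \<Lambda> S\<^sup>-\<^sup>1\<close> of the reduced matrix decouples this system: the variation
  of constants formula for the eigencoordinates \<open>S\<^sup>-\<^sup>1 a\<close> needs only the exponential of
  a diagonal matrix, and taking norms inside the integral yields the two condition-number
  factors (lemma \<open>eigendecomposition_duhamel_bound\<close>).
\<close>

section \<open>The induced norm and the exponential of complex matrices\<close>

lemma norm_matrix_vector_le:
  fixes M :: "complex^'k^'m"
  shows "norm (M *v x) \<le> matrix_norm2 M * norm x"
  unfolding matrix_norm2_def by (rule onorm) simp

lemma matrix_norm2_nonneg: "0 \<le> matrix_norm2 (M :: complex^'k^'m)"
  unfolding matrix_norm2_def by (rule onorm_pos_le) simp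

text \<open>The induced norm is the norm of the associated bounded operator, and operators on a
  finite-dimensional space depend continuously on a parameter as soon as their values on a
  basis do.\<close>

lemma continuous_on_matrix_norm2:
  fixes f :: "'a::t2_space \<Rightarrow> complex^'k^'m"
  assumes "continuous_on X f"
  shows "continuous_on X (\<lambda>s. matrix_norm2 (f s))"
proof -
  have apply_eq: "blinfun_apply (Blinfun ((*v) (f s))) x = f s *v x" for s x
    by (simp add: bounded_linear_Blinfun_apply)
  have "continuous_on X (\<lambda>s. f s *v x)" for x
    unfolding matrix_vector_mult_def
    by (intro continuous_intros assms)
  then have "continuous_on X (\<lambda>s. Blinfun ((*v) (f s)))"
    by (intro continuous_on_blinfun_componentwise) (simp add: apply_eq)
  then have "continuous_on X (\<lambda>s. norm (Blinfun ((*v) (f s))))"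
    by (rule continuous_on_norm)
  moreover have "norm (Blinfun ((*v) (f s))) = matrix_norm2 (f s)" for s
    by (simp add: norm_blinfun.rep_eq apply_eq[abs_def] matrix_norm2_def)
  ultimately show ?thesis by simp
qed

lemma diagonal_matrix_power:
  fixes L :: "complex^'k^'k"
  assumes diag: "\<And>i j. i \<noteq> j \<Longrightarrow> L $ i $ j = 0"
  shows "((**) L ^^ p) (mat 1) = (\<chi> i j. if i = j then (L $ i $ i) ^ p else 0)"
proof (induction p)
  case 0
  show ?case by (simp add: mat_def vec_eq_iff)
next
  case (Suc p)
  have "(\<Sum>k\<in>UNIV. L $ i $ k * (if k = j then (L $ k $ k) ^ p else 0))
      = (if i = j then (L $ i $ i) ^ Suc p else 0)" for i j
    using diag[of i j] by (simp add: if_distrib[of "\<lambda>x. _ * x"] cong: if_cong)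
  then have "L ** (\<chi> i j. if i = j then (L $ i $ i) ^ p else 0)
      = (\<chi> i j. if i = j then (L $ i $ i) ^ Suc p else 0)"
    by (simp only: matrix_matrix_mult_def vec_lambda_beta)
  then show ?case
    by (simp add: Suc)
qed

text \<open>The powers of a diagonal matrix are the powers of its entries, so each diagonal entry of
  the series is a scalar exponential series.\<close>

lemma matrix_exp_diagonal:
  fixes L :: "complex^'k^'k"
  assumes diag: "\<And>i j. i \<noteq> j \<Longrightarrow> L $ i $ j = 0"
  shows "matrix_exp L = (\<chi> i j. if i = j then exp (L $ i $ i) else 0)"
proof -
  have entry: "(\<lambda>p. (1 / fact p) *\<^sub>R (if i = j then (L $ i $ i) ^ p else 0))
      sums (if i = j then exp (L $ i $ i) else 0)" for i j
    using exp_converges[of "L $ i $ i"] by (auto simp: inverse_eq_divide)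
  have "(\<lambda>p. (1 / fact p) *\<^sub>R (((**) L ^^ p) (mat 1)))
      sums (\<chi> i j. if i = j then exp (L $ i $ i) else 0)"
    unfolding sums_def
  proof (intro vec_tendstoI)
    fix i j
    show "(\<lambda>n. (\<Sum>p<n. (1 / fact p) *\<^sub>R (((**) L ^^ p) (mat 1))) $ i $ j)
        \<longlonglongrightarrow> (\<chi> i j. if i = j then exp (L $ i $ i) else 0) $ i $ j"
      using entry[of i j]
      by (simp add: sums_def diagonal_matrix_power[OF diag])
  qed
  then show ?thesis
    unfolding matrix_exp_def by (rule sums_unique[symmetric])
qed

section \<open>Real vectors and matrices inside the complex ones\<close>

text \<open>The eigencoordinates of a real system may be complex. Embedding the real coordinates
  entrywise is isometric and commutes with real matrices, so the estimate can be made over the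
  complex numbers and read off over the reals.\<close>

lemma norm_map_complex_of_real:
  "norm (\<chi> i. complex_of_real (x $ i)) = norm (x :: real^'k)"
  by (simp add: norm_vec_def)

lemma map_matrix_of_real_mult:
  fixes M :: "real^'k^'m"
  shows "map_matrix complex_of_real M *v (\<chi> i. complex_of_real (x $ i))
    = (\<chi> i. complex_of_real ((M *v x) $ i))"
  by (simp add: matrix_vector_mult_def vec_eq_iff)

lemma bounded_linear_map_complex_of_real:
  "bounded_linear (\<lambda>x :: real^'k. \<chi> i. complex_of_real (x $ i))"
proof (rule bounded_linear_intro[where K = 1])
  show "norm (\<chi> i. complex_of_real (x $ i)) \<le> norm x * 1" for x :: "real^'k"
    by (simp add: norm_map_complex_of_real)
qed (simp_all add: vec_eq_iff scaleR_conv_of_real[where 'a = complex])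

section \<open>Variation of constants in eigencoordinates\<close>

lemma has_vector_derivative_vecI:
  fixes f :: "real \<Rightarrow> 'a::real_normed_vector^'k"
  assumes "\<And>i. ((\<lambda>s. f s $ i) has_vector_derivative f' $ i) (at t within X)"
  shows "(f has_vector_derivative f') (at t within X)"
  unfolding has_vector_derivative_def has_derivative_def
proof (intro conjI vec_tendstoI)
  show "bounded_linear (\<lambda>h. h *\<^sub>R f')"
    by (rule bounded_linear_scaleR_left)
  show "((\<lambda>y. ((f y - f (Lim (at t within X) (\<lambda>x. x))
        - (y - Lim (at t within X) (\<lambda>x. x)) *\<^sub>R f')
        /\<^sub>R norm (y - Lim (at t within X) (\<lambda>x. x))) $ i) \<longlongrightarrow> 0 $ i) (at t within X)" for i
    using assms[of i] by (simp add: has_vector_derivative_def has_derivative_def)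
qed

text \<open>The integrating factor \<open>exp ((t - s) \<Lambda>)\<close> turns \<open>z' = \<Lambda> z + h\<close> into a total derivative. For
  diagonal \<open>\<Lambda>\<close> the system decouples, so that this is a statement about scalar exponentials.\<close>

lemma diagonal_duhamel:
  fixes L :: "complex^'k^'k" and z h :: "real \<Rightarrow> complex^'k"
  assumes diag: "\<And>i j. i \<noteq> j \<Longrightarrow> L $ i $ j = 0"
    and "0 \<le> t" and "z 0 = 0"
    and deriv: "\<And>s. s \<in> {0..t} \<Longrightarrow> (z has_vector_derivative L *v z s + h s) (at s within {0..t})"
  shows "((\<lambda>s. matrix_exp ((t - s) *\<^sub>R L) *v h s) has_integral z t) {0..t}"
proof -
  have component: "(L *v x) $ i = L $ i $ i * x $ i" for x i
  proof -
    have "L $ i $ j * x $ j = (if j = i then L $ i $ i * x $ i else 0)" for j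
      using diag[of i j] by auto
    then have "(L *v x) $ i = (\<Sum>j\<in>UNIV. if j = i then L $ i $ i * x $ i else 0)"
      unfolding matrix_vector_mult_def vec_lambda_beta by (rule sum.cong[OF refl])
    then show ?thesis by simp
  qed
  have exp_component:
    "(matrix_exp (r *\<^sub>R L) *v x) $ i = exp (r *\<^sub>R L $ i $ i) * x $ i" for r x i
  proof -
    have "matrix_exp (r *\<^sub>R L) $ i $ j * x $ j
        = (if j = i then exp (r *\<^sub>R L $ i $ i) * x $ i else 0)" for j
      by (auto simp: matrix_exp_diagonal diag)
    then show ?thesis by (simp add: matrix_vector_mult_def)
  qed
  have total: "((\<lambda>s. matrix_exp ((t - s) *\<^sub>R L) *v z s) has_vector_derivative
      matrix_exp ((t - s) *\<^sub>R L) *v h s) (at s within {0..t})" if "s \<in> {0..t}" for s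
  proof (rule has_vector_derivative_vecI)
    fix i
    let ?l = "L $ i $ i"
    have z_i: "((\<lambda>s. z s $ i) has_vector_derivative ?l * z s $ i + h s $ i) (at s within {0..t})"
      using bounded_linear.has_vector_derivative[OF bounded_linear_vec_nth deriv[OF that], of i]
      by (simp add: component)
    have "((\<lambda>s. (t - s) *\<^sub>R ?l) has_vector_derivative - ?l) (at s within {0..t})"
      by (auto intro!: derivative_eq_intros)
    then have "((\<lambda>s. exp ((t - s) *\<^sub>R ?l)) has_vector_derivative
        - ?l * exp ((t - s) *\<^sub>R ?l)) (at s within {0..t})"
      using field_vector_diff_chain_within[where g = exp] DERIV_exp[THEN DERIV_subset]
      by (fastforce simp: o_def)
    from has_vector_derivative_mult[OF this z_i]
    have "((\<lambda>s. exp ((t - s) *\<^sub>R ?l) * z s $ i) has_vector_derivative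
        exp ((t - s) *\<^sub>R ?l) * h s $ i) (at s within {0..t})"
      by (simp add: algebra_simps)
    then show "((\<lambda>s. (matrix_exp ((t - s) *\<^sub>R L) *v z s) $ i) has_vector_derivative
        (matrix_exp ((t - s) *\<^sub>R L) *v h s) $ i) (at s within {0..t})"
      by (simp only: exp_component)
  qed
  have "matrix_exp ((t - t) *\<^sub>R L) *v z t = z t"
    by (simp only: vec_eq_iff exp_component) simp
  then show ?thesis
    using fundamental_theorem_of_calculus[OF \<open>0 \<le> t\<close> total] \<open>z 0 = 0\<close> by simp
qed

text \<open>In the eigencoordinates \<open>z = S\<^sup>-\<^sup>1 a\<close> the equation becomes diagonal, with \<open>S\<^sup>-\<^sup>1 g\<close> as its
  source. One factor of the condition number is paid for this source and the other for
  returning from \<open>z\<close> to \<open>a\<close>. The continuity of \<open>g\<close> makes the dominating scalar function integrable,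
  without which its integral would not bound anything.\<close>

lemma eigendecomposition_duhamel_bound:
  fixes M :: "real^'k^'k" and a g :: "real \<Rightarrow> real^'k"
  assumes eig: "eigendecomposition M S L"
    and "0 \<le> t" and "a 0 = 0"
    and deriv: "\<And>s. s \<in> {0..t} \<Longrightarrow> (a has_vector_derivative M *v a s + g s) (at s within {0..t})"
    and cont: "continuous_on {0..t} g"
  shows "norm (a t) \<le> matrix_norm2 S * matrix_norm2 (matrix_inv S) *
    integral {0..t} (\<lambda>s. matrix_norm2 (matrix_exp ((t - s) *\<^sub>R L)) * norm (g s))"
proof -
  let ?c = "\<lambda>x :: real^'k. \<chi> i. complex_of_real (x $ i)"
  let ?R = "matrix_inv S"
  let ?E = "\<lambda>s. matrix_exp ((t - s) *\<^sub>R L)"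
  define z where "z s = ?R *v ?c (a s)" for s
  have diag: "L $ i $ j = 0" if "i \<noteq> j" for i j
    using eig that by (simp add: eigendecomposition_def)
  have inv: "?R ** S = mat 1" "S ** ?R = mat 1"
    using eig someI_ex[of "\<lambda>R. S ** R = mat 1 \<and> R ** S = mat 1"]
    by (auto simp: eigendecomposition_def invertible_def matrix_inv_def)
  \<comment> \<open>The relation \<open>S\<^sup>-\<^sup>1 M = \<Lambda> S\<^sup>-\<^sup>1\<close> passes \<open>M\<close> through the change of coordinates.\<close>
  have "?R ** map_matrix complex_of_real M = L ** ?R"
    using eig inv by (simp add: eigendecomposition_def matrix_mul_assoc)
  then have conj: "?R *v ?c (M *v x) = L *v (?R *v ?c x)" for x
    by (metis map_matrix_of_real_mult matrix_vector_mul_assoc)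
  have bl: "bounded_linear (\<lambda>x. ?R *v ?c x)"
    using bounded_linear_compose[OF matrix_vector_mul_bounded_linear
        bounded_linear_map_complex_of_real] .
  have z_deriv: "(z has_vector_derivative L *v z s + ?R *v ?c (g s)) (at s within {0..t})"
    if "s \<in> {0..t}" for s
    using bounded_linear.has_vector_derivative[OF bl deriv[OF that]]
    unfolding z_def[abs_def] by (simp only: linear_add[OF bounded_linear.linear[OF bl]] conj)
  have "z 0 = 0"
    using linear_0[OF bounded_linear.linear[OF bl]] \<open>a 0 = 0\<close> by (simp add: z_def)
  with diag \<open>0 \<le> t\<close> z_deriv
  have duhamel: "((\<lambda>s. ?E s *v (?R *v ?c (g s))) has_integral z t) {0..t}"
    by (intro diagonal_duhamel)
  have "continuous_on {0..t} ?E"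
  proof -
    have "?E s = (\<chi> i j. if i = j then exp ((t - s) *\<^sub>R L $ i $ i) else 0)" for s
      by (simp add: matrix_exp_diagonal diag cong: if_cong)
    moreover have "continuous_on {0..t} (\<lambda>s. if i = j then exp ((t - s) *\<^sub>R L $ i $ i) else 0)"
      for i j by (cases "i = j") (auto intro!: continuous_intros)
    ultimately show ?thesis
      by (simp add: continuous_on_vec_lambda)
  qed
  then have integrable: "(\<lambda>s. matrix_norm2 (?E s) * norm (g s)) integrable_on {0..t}"
    by (intro integrable_continuous_interval continuous_intros continuous_on_matrix_norm2 cont)
  have pointwise: "norm (?E s *v (?R *v ?c (g s)))
      \<le> matrix_norm2 ?R * (matrix_norm2 (?E s) * norm (g s))" for s
  proof -
    have "norm (?E s *v (?R *v ?c (g s))) \<le> matrix_norm2 (?E s) * norm (?R *v ?c (g s))"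
      by (rule norm_matrix_vector_le)
    also have "\<dots> \<le> matrix_norm2 (?E s) * (matrix_norm2 ?R * norm (g s))"
      using norm_matrix_vector_le[of ?R "?c (g s)"]
      by (intro mult_left_mono matrix_norm2_nonneg) (simp add: norm_map_complex_of_real)
    finally show ?thesis by (simp add: algebra_simps)
  qed
  have "norm (integral {0..t} (\<lambda>s. ?E s *v (?R *v ?c (g s))))
      \<le> integral {0..t} (\<lambda>s. matrix_norm2 ?R * (matrix_norm2 (?E s) * norm (g s)))"
    using duhamel integrable pointwise
    by (intro integral_norm_bound_integral integrable_on_mult_right) auto
  then have z_bound: "norm (z t)
      \<le> matrix_norm2 ?R * integral {0..t} (\<lambda>s. matrix_norm2 (?E s) * norm (g s))"
    using integral_unique[OF duhamel] by simp
  have "S *v z t = ?c (a t)"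
    by (simp add: z_def matrix_vector_mul_assoc inv)
  then have "norm (a t) \<le> matrix_norm2 S * norm (z t)"
    using norm_matrix_vector_le[of S "z t"] by (simp add: norm_map_complex_of_real)
  also have "\<dots> \<le> matrix_norm2 S *
      (matrix_norm2 ?R * integral {0..t} (\<lambda>s. matrix_norm2 (?E s) * norm (g s)))"
    by (intro mult_left_mono z_bound matrix_norm2_nonneg)
  finally show ?thesis by (simp add: mult.assoc)
qed

section \<open>The coarse space\<close>

lemma orthonormal_columns_gram:
  assumes "orthonormal_columns V"
  shows "transpose V ** V = mat 1"
  using assms
  by (simp add: orthonormal_columns_def matrix_matrix_mult_def transpose_def mat_def
      vec_eq_iff column_def inner_vec_def)

lemma norm_orthonormal_columns_mult:
  assumes "orthonormal_columns V"
  shows "norm (V *v x) = norm x"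
proof -
  have "(V *v x) \<bullet> (V *v x) = (transpose V *v (V *v x)) \<bullet> x"
    by (simp add: dot_lmul_matrix[symmetric] transpose_matrix_vector inner_commute)
  then show ?thesis
    by (simp add: matrix_vector_mul_assoc orthonormal_columns_gram[OF assms] norm_eq_sqrt_inner)
qed

lemma coarse_proj_idem:
  assumes "orthonormal_columns V"
  shows "coarse_proj V ** coarse_proj V = coarse_proj V"
  by (metis assms coarse_proj_def matrix_mul_assoc matrix_mul_rid orthonormal_columns_gram)

lemma coarse_proj_range:
  assumes "orthonormal_columns V" and "x \<in> range ((*v) V)"
  shows "coarse_proj V *v x = x"
proof -
  have "V ** transpose V ** V = V"
    by (simp add: matrix_mul_assoc[symmetric] orthonormal_columns_gram[OF assms(1)])
  then show ?thesis
    using assms(2) by (auto simp: coarse_proj_def matrix_vector_mul_assoc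
        simp del: transpose_matrix_vector)
qed

lemma coarse_proj_proj_A:
  assumes "orthonormal_columns V"
  shows "coarse_proj V ** proj_A \<tau> A V = proj_A \<tau> A V"
  by (simp add: proj_A_def matrix_mul_assoc coarse_proj_idem[OF assms])

text \<open>The correction \<open>\<tau> A \<Pi>'\<close> vanishes on the coarse space, because \<open>\<Pi>'\<close> does.\<close>

lemma proj_A_coarse_proj:
  assumes "orthonormal_columns V"
  shows "proj_A \<tau> A V ** coarse_proj V = coarse_proj V"
proof -
  have "fine_proj V *v (coarse_proj V *v x) = 0" for x
    unfolding fine_proj_def coarse_proj_def[symmetric]
    by (simp add: matrix_vector_mult_diff_rdistrib)
       (simp add: matrix_vector_mul_assoc coarse_proj_idem[OF assms])
  then have "proj_A \<tau> A V *v (coarse_proj V *v x) = coarse_proj V *v x" for x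
    by (simp add: proj_A_def matrix_vector_mul_assoc[symmetric] matrix_vector_mult_add_rdistrib
        scaleR_matrix_vector_assoc[symmetric])
       (simp add: matrix_vector_mul_assoc coarse_proj_idem[OF assms])
  then show ?thesis
    by (simp add: matrix_eq matrix_vector_mul_assoc)
qed

text \<open>A velocity in the coarse space leaves the fine part of the trajectory constant, and
  this part is zero initially.\<close>

lemma coarse_trajectory:
  fixes u :: "real \<Rightarrow> real^'n"
  assumes deriv: "\<And>s. s \<in> {0..T} \<Longrightarrow> (u has_vector_derivative u' s) (at s within {0..T})"
    and coarse: "\<And>s. s \<in> {0..T} \<Longrightarrow> coarse_proj V *v u' s = u' s"
    and init: "coarse_proj V *v u 0 = u 0"
    and "s \<in> {0..T}"
  shows "coarse_proj V *v u s = u s"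
proof -
  have "((\<lambda>s. u s - coarse_proj V *v u s) has_vector_derivative 0) (at r within {0..T})"
    if "r \<in> {0..T}" for r
    using has_vector_derivative_diff[OF deriv[OF that]
        bounded_linear.has_vector_derivative[OF matrix_vector_mul_bounded_linear deriv[OF that]],
        of "coarse_proj V"]
    by (simp add: coarse[OF that])
  then show ?thesis
  proof (rule has_vector_derivative_zero_constant[OF convex_real_interval(5)])
    fix c assume "\<And>r. r \<in> {0..T} \<Longrightarrow> u r - coarse_proj V *v u r = c"
    from this[of 0] this[of s] show ?thesis
      using init \<open>s \<in> {0..T}\<close> by auto
  qed
qed

section \<open>The error of a projected model\<close>

text \<open>The two identities for \<open>P\<close> are all that distinguishes the projectors of interest.
  The first keeps the reduced trajectory in the coarse space. The second makes
  the time derivative of the coarse part of the full-order solution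
  equal to its image under \<open>P\<close>, so that only the projected residual drives the error.\<close>

lemma projected_model_error_bound:
  fixes V :: "real^'k^'n" and A P :: "real^'n^'n" and u\<^sub>F u :: "real \<Rightarrow> real^'n"
  assumes "T > 0" and orth: "orthonormal_columns V"
    and coarse_P: "coarse_proj V ** P = P" and P_coarse: "P ** coarse_proj V = coarse_proj V"
    and init: "u 0 \<in> range ((*v) V)" "u\<^sub>F 0 = u 0"
    and F: "\<And>s. s \<in> {0..T} \<Longrightarrow> (u\<^sub>F has_vector_derivative A *v u\<^sub>F s) (at s within {0..T})"
    and R: "\<And>s. s \<in> {0..T} \<Longrightarrow> (u has_vector_derivative (P ** A) *v u s) (at s within {0..T})"
    and eig: "eigendecomposition (transpose V ** P ** A ** V) S L"
    and t: "t \<in> {0..T}"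
  shows "norm (coarse_proj V *v u\<^sub>F t - u t) \<le> matrix_norm2 S * matrix_norm2 (matrix_inv S) *
    integral {0..t} (\<lambda>s. matrix_norm2 (matrix_exp ((t - s) *\<^sub>R L)) *
      norm ((transpose V ** P) *v residual_F A T (\<lambda>r. coarse_proj V *v u\<^sub>F r) s))"
proof -
  let ?C = "coarse_proj V" and ?W = "transpose V"
  define r where "r s = ?C *v (A *v u\<^sub>F s) - A *v (?C *v u\<^sub>F s)" for s
  define e where "e s = ?C *v u\<^sub>F s - u s" for s
  have coarse_F: "((\<lambda>s. ?C *v u\<^sub>F s) has_vector_derivative ?C *v (A *v u\<^sub>F s)) (at s within {0..T})"
    if "s \<in> {0..T}" for s
    by (rule bounded_linear.has_vector_derivative[OF matrix_vector_mul_bounded_linear F[OF that]])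
  have residual: "residual_F A T (\<lambda>r. ?C *v u\<^sub>F r) s = r s" if "s \<in> {0..T}" for s
    using vector_derivative_within_cbox[of 0 T s] coarse_F[OF that] \<open>T > 0\<close> that
    by (simp add: residual_F_def r_def)
  have u_coarse: "?C *v u s = u s" if "s \<in> {0..T}" for s
  proof (rule coarse_trajectory[OF R _ _ that])
    show "?C *v ((P ** A) *v u s) = (P ** A) *v u s" for s
      by (simp add: matrix_vector_mul_assoc matrix_mul_assoc coarse_P)
    show "?C *v u 0 = u 0"
      by (rule coarse_proj_range[OF orth init(1)])
  qed
  have e_coarse: "V *v (?W *v e s) = e s" if "s \<in> {0..T}" for s
  proof -
    have "?C *v e s = e s"
      by (simp add: e_def u_coarse[OF that] matrix_vector_mult_diff_distrib
          matrix_vector_mul_assoc coarse_proj_idem[OF orth])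
    then show ?thesis by (simp only: coarse_proj_def matrix_vector_mul_assoc)
  qed
  have rhs: "?W *v (?C *v (A *v u\<^sub>F s) - (P ** A) *v u s)
      = (?W ** P ** A ** V) *v (?W *v e s) + (?W ** P) *v r s" if "s \<in> {0..T}" for s
  proof -
    have "(?W ** P ** A ** V) *v (?W *v e s) = ?W *v (P *v (A *v e s))"
      by (simp only: e_coarse[OF that] matrix_vector_mul_assoc[symmetric])
    moreover have "P *v (?C *v x) = ?C *v x" for x
      by (simp add: matrix_vector_mul_assoc P_coarse)
    ultimately show ?thesis
      by (simp add: e_def r_def matrix_vector_mul_assoc[symmetric] matrix_vector_mult_diff_distrib
          del: transpose_matrix_vector)
  qed
  have deriv: "((\<lambda>s. ?W *v e s) has_vector_derivative
      (?W ** P ** A ** V) *v (?W *v e s) + (?W ** P) *v r s) (at s within {0..t})"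
    if "s \<in> {0..t}" for s
  proof -
    have s: "s \<in> {0..T}" using that t by simp
    have "(e has_vector_derivative ?C *v (A *v u\<^sub>F s) - (P ** A) *v u s) (at s within {0..T})"
      unfolding e_def[abs_def] by (rule has_vector_derivative_diff[OF coarse_F[OF s] R[OF s]])
    then have "((\<lambda>s. ?W *v e s) has_vector_derivative
        (?W ** P ** A ** V) *v (?W *v e s) + (?W ** P) *v r s) (at s within {0..T})"
      unfolding rhs[OF s, symmetric]
      by (rule bounded_linear.has_vector_derivative[OF matrix_vector_mul_bounded_linear])
    then show ?thesis
      using t by (auto intro: has_vector_derivative_within_subset)
  qed
  have "continuous_on {0..t} u\<^sub>F"
    using continuous_on_vector_derivative[OF F] t by (auto intro: continuous_on_subset)
  then have cont: "continuous_on {0..t} (\<lambda>s. (?W ** P) *v r s)"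
    unfolding r_def
    by (intro continuous_intros bounded_linear.continuous_on[OF matrix_vector_mul_bounded_linear])
  have "e 0 = 0"
    using coarse_proj_range[OF orth init(1)] init(2) by (simp add: e_def)
  have "norm (e t) = norm (?W *v e t)"
    using norm_orthonormal_columns_mult[OF orth, of "?W *v e t"] e_coarse[OF t] by simp
  also have "\<dots> \<le> matrix_norm2 S * matrix_norm2 (matrix_inv S) *
      integral {0..t} (\<lambda>s. matrix_norm2 (matrix_exp ((t - s) *\<^sub>R L)) * norm ((?W ** P) *v r s))"
    using t \<open>e 0 = 0\<close> by (intro eigendecomposition_duhamel_bound[OF eig] deriv cont) auto
  also have "integral {0..t} (\<lambda>s. matrix_norm2 (matrix_exp ((t - s) *\<^sub>R L)) * norm ((?W ** P) *v r s))
      = integral {0..t} (\<lambda>s. matrix_norm2 (matrix_exp ((t - s) *\<^sub>R L)) *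
          norm ((?W ** P) *v residual_F A T (\<lambda>r. ?C *v u\<^sub>F r) s))"
    using t by (intro integral_cong) (simp add: residual)
  finally show ?thesis by (simp add: e_def)
qed

theorem theorem2:
  fixes V :: "real^'k^'n"
    and A :: "real^'n^'n"
    and T \<tau> :: real
    and u\<^sub>0 :: "real^'n"
    and u\<^sub>F u\<^sub>G u\<^sub>A e\<^sub>G e\<^sub>A :: "real \<Rightarrow> real^'n"
    and S\<^sub>G \<Lambda>\<^sub>G S\<^sub>A \<Lambda>\<^sub>A :: "complex^'k^'k"
  assumes "CARD('k) \<le> CARD('n)"
    and "T > 0"
    and "\<tau> \<ge> 0"
    and "orthonormal_columns V"
    and "u\<^sub>0 \<in> range ((*v) V)"
    and "\<forall>t\<in>{0..T}. (u\<^sub>F has_vector_derivative A *v u\<^sub>F t) (at t within {0..T})"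
    and "\<forall>t\<in>{0..T}. (u\<^sub>G has_vector_derivative (proj_G V ** A) *v u\<^sub>G t) (at t within {0..T})"
    and "\<forall>t\<in>{0..T}. (u\<^sub>A has_vector_derivative (proj_A \<tau> A V ** A) *v u\<^sub>A t) (at t within {0..T})"
    and "u\<^sub>F 0 = u\<^sub>0" and "u\<^sub>G 0 = u\<^sub>0" and "u\<^sub>A 0 = u\<^sub>0"
    and "\<forall>t\<in>{0..T}. e\<^sub>G t = coarse_proj V *v u\<^sub>F t - u\<^sub>G t"
    and "\<forall>t\<in>{0..T}. e\<^sub>A t = coarse_proj V *v u\<^sub>F t - u\<^sub>A t"
    and "eigendecomposition (transpose V ** proj_G V ** A ** V) S\<^sub>G \<Lambda>\<^sub>G"
    and "eigendecomposition (transpose V ** proj_A \<tau> A V ** A ** V) S\<^sub>A \<Lambda>\<^sub>A"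
  shows "\<forall>t\<in>{0..T}.
      norm (e\<^sub>G t) \<le> matrix_norm2 S\<^sub>G * matrix_norm2 (matrix_inv S\<^sub>G) *
        integral {0..t} (\<lambda>s. matrix_norm2 (matrix_exp ((t - s) *\<^sub>R \<Lambda>\<^sub>G)) *
          norm ((transpose V ** proj_G V) *v residual_F A T (\<lambda>r. coarse_proj V *v u\<^sub>F r) s))
    \<and> norm (e\<^sub>A t) \<le> matrix_norm2 S\<^sub>A * matrix_norm2 (matrix_inv S\<^sub>A) *
        integral {0..t} (\<lambda>s. matrix_norm2 (matrix_exp ((t - s) *\<^sub>R \<Lambda>\<^sub>A)) *
          norm ((transpose V ** proj_A \<tau> A V) *v residual_F A T (\<lambda>r. coarse_proj V *v u\<^sub>F r) s))"
proof (intro ballI conjI)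
  fix t assume t: "t \<in> {0..T}"
  note orth = assms(4)
  have proj_G: "coarse_proj V ** proj_G V = proj_G V" "proj_G V ** coarse_proj V = coarse_proj V"
    by (simp_all add: proj_G_def coarse_proj_idem[OF orth])
  have "norm (coarse_proj V *v u\<^sub>F t - u\<^sub>G t)
      \<le> matrix_norm2 S\<^sub>G * matrix_norm2 (matrix_inv S\<^sub>G) *
      integral {0..t} (\<lambda>s. matrix_norm2 (matrix_exp ((t - s) *\<^sub>R \<Lambda>\<^sub>G)) *
        norm ((transpose V ** proj_G V) *v residual_F A T (\<lambda>r. coarse_proj V *v u\<^sub>F r) s))"
  proof (rule projected_model_error_bound[OF \<open>T > 0\<close> orth proj_G(1) proj_G(2)
        _ _ _ _ assms(14) t])
    show "u\<^sub>G 0 \<in> range ((*v) V)" "u\<^sub>F 0 = u\<^sub>G 0"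
      by (simp_all only: assms(5,9,10))
  qed (use assms(6,7) in blast)+
  then show "norm (e\<^sub>G t) \<le> matrix_norm2 S\<^sub>G * matrix_norm2 (matrix_inv S\<^sub>G) *
      integral {0..t} (\<lambda>s. matrix_norm2 (matrix_exp ((t - s) *\<^sub>R \<Lambda>\<^sub>G)) *
        norm ((transpose V ** proj_G V) *v residual_F A T (\<lambda>r. coarse_proj V *v u\<^sub>F r) s))"
    by (simp only: bspec[OF assms(12) t])
  have "norm (coarse_proj V *v u\<^sub>F t - u\<^sub>A t)
      \<le> matrix_norm2 S\<^sub>A * matrix_norm2 (matrix_inv S\<^sub>A) *
      integral {0..t} (\<lambda>s. matrix_norm2 (matrix_exp ((t - s) *\<^sub>R \<Lambda>\<^sub>A)) *
        norm ((transpose V ** proj_A \<tau> A V) *v residual_F A T (\<lambda>r. coarse_proj V *v u\<^sub>F r) s))"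
  proof (rule projected_model_error_bound[OF \<open>T > 0\<close> orth coarse_proj_proj_A[OF orth] proj_A_coarse_proj[OF orth]
        _ _ _ _ assms(15) t])
    show "u\<^sub>A 0 \<in> range ((*v) V)" "u\<^sub>F 0 = u\<^sub>A 0"
      by (simp_all only: assms(5,9,11))
  qed (use assms(6,8) in blast)+
  then show "norm (e\<^sub>A t) \<le> matrix_norm2 S\<^sub>A * matrix_norm2 (matrix_inv S\<^sub>A) *
      integral {0..t} (\<lambda>s. matrix_norm2 (matrix_exp ((t - s) *\<^sub>R \<Lambda>\<^sub>A)) *
        norm ((transpose V ** proj_A \<tau> A V) *v residual_F A T (\<lambda>r. coarse_proj V *v u\<^sub>F r) s))"
    by (simp only: bspec[OF assms(13) t])
qed

end
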